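(* Let $a_{n,m},b_{n,m},c_{n,m},d_{n,m}$, $(n,m)\in\mathbb{Z}_+^2$, be real coefficients satisfying the consistency (discrete zero curvature) conditions and the boundary conditions given in the context. Suppose in addition that $c_{n,m}$ and $d_{n,m}$ satisfy $$c_{n+1,m}-d_{n+1,m}=c_{n,m+1}-d_{n,m+1}\qquad (n,m\in\mathbb{Z}_+).$$ Let $\Delta$ be the operator $$(\Delta f)_{n,m}=\tfrac12 f_{n+1,m}+\tfrac12 f_{n,m+1}+\tfrac{c_{n,m}+d_{n,m}}{2}f_{n,m}+a_{n,m}f_{n-1,m}+b_{n,m}f_{n,m-1}.$$ Then there exists a family $h_{n,m}\ne0$ defined on $\mathbb{Z}_+^2$ such that the diagonal operator $(Df)_{n,m}=h_{n,m}f_{n,m}$ symmetrizes the operator $\Delta$ by means of a similarity transformation, that is, the operator $\Delta_s=D^{-1}\Delta D$ is symmetric in $\ell^2(\mathbb{Z}_+^2)$.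
   Context: $\mathbb{Z}_+=\{0,1,2,\dots\}$; $f=(f_{n,m})$ denotes a sequence on $\mathbb{Z}_+^2$, with $f_{-1,m}=f_{n,-1}=0$. $\ell^2(\mathbb{Z}_+^2)$ is the space of square summable families on $\mathbb{Z}_+^2$ with its standard inner product, and the difference expression $\Delta$ generates an operator in it, also denoted by $\Delta$. The boundary conditions are $a_{0,m}=b_{n,0}=0$, and $a_{n,0}>0$, $b_{0,m}>0$ for $n,m>0$. The consistency conditions are, for $n,m\in\mathbb{Z}_+$ and with $c_{n,m}\ne d_{n,m}$, $$c_{n,m+1}=c_{n,m}+\frac{(a_{n+1,m}+b_{n+1,m})-(a_{n,m+1}+b_{n,m+1})}{c_{n,m}-d_{n,m}},$$ $$d_{n+1,m}=d_{n,m}+\frac{(a_{n+1,m}+b_{n+1,m})-(a_{n,m+1}+b_{n,m+1})}{c_{n,m}-d_{n,m}},$$ $$\frac{a_{n,m+1}}{a_{n,m}}=\frac{c_{n,m}-d_{n,m}}{c_{n-1,m}-d_{n-1,m}}\ (n\ge1),\qquad \frac{b_{n+1,m}}{b_{n,m}}=\frac{c_{n,m}-d_{n,m}}{c_{n,m-1}-d_{n,m-1}}\ (m\ge1).$$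
   Formalization: Symmetry in ℓ² for the standard inner product is claimed only if a_{n,m}>0 (n≥1) and b_{n,m}>0 (m≥1) everywhere, which is necessary and can fail under the stated conditions; in general Δ_s is only shown equal to its transpose, with h possibly complex. *)

theory Defs
  imports "HOL-Analysis.Analysis"
begin

type_synonym coeffs = "nat \<Rightarrow> nat \<Rightarrow> real"
type_synonym lattice_fun = "nat \<times> nat \<Rightarrow> complex"

text \<open>In the two ratio equations the denominators \<open>a n m\<close> (\<open>n \<ge> 1\<close>) and \<open>b n m\<close> (\<open>m \<ge> 1\<close>) need no
  separate nonvanishing clause: the right-hand sides are nonzero because \<open>c \<noteq> d\<close>, while
  \<open>x / 0 = 0\<close>, so the equations themselves exclude zero denominators.\<close>

definition consistency_conditions :: "coeffs \<Rightarrow> coeffs \<Rightarrow> coeffs \<Rightarrow> coeffs \<Rightarrow> bool" where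
  "consistency_conditions a b c d \<longleftrightarrow>
     (\<forall>n m. c n m \<noteq> d n m) \<and>
     (\<forall>n m. c n (m + 1) = c n m +
        ((a (n + 1) m + b (n + 1) m) - (a n (m + 1) + b n (m + 1))) / (c n m - d n m)) \<and>
     (\<forall>n m. d (n + 1) m = d n m +
        ((a (n + 1) m + b (n + 1) m) - (a n (m + 1) + b n (m + 1))) / (c n m - d n m)) \<and>
     (\<forall>n m. n \<ge> 1 \<longrightarrow>
        a n (m + 1) / a n m = (c n m - d n m) / (c (n - 1) m - d (n - 1) m)) \<and>
     (\<forall>n m. m \<ge> 1 \<longrightarrow>
        b (n + 1) m / b n m = (c n m - d n m) / (c n (m - 1) - d n (m - 1)))"

definition boundary_conditions :: "coeffs \<Rightarrow> coeffs \<Rightarrow> bool" where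
  "boundary_conditions a b \<longleftrightarrow>
     (\<forall>m. a 0 m = 0) \<and> (\<forall>n. b n 0 = 0) \<and> (\<forall>n>0. a n 0 > 0) \<and> (\<forall>m>0. b 0 m > 0)"

definition Delta :: "coeffs \<Rightarrow> coeffs \<Rightarrow> coeffs \<Rightarrow> coeffs \<Rightarrow> lattice_fun \<Rightarrow> lattice_fun" where
  "Delta a b c d f = (\<lambda>(n, m).
       1 / 2 * f (n + 1, m) + 1 / 2 * f (n, m + 1)
     + complex_of_real ((c n m + d n m) / 2) * f (n, m)
     + complex_of_real (a n m) * (if n = 0 then 0 else f (n - 1, m))
     + complex_of_real (b n m) * (if m = 0 then 0 else f (n, m - 1)))"

definition diagonal_op :: "lattice_fun \<Rightarrow> lattice_fun \<Rightarrow> lattice_fun" where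
  "diagonal_op h f = (\<lambda>p. h p * f p)"

definition ell2 :: "lattice_fun set" where
  "ell2 = {f. (\<lambda>p. (cmod (f p))\<^sup>2) summable_on UNIV}"

definition ell2_norm :: "lattice_fun \<Rightarrow> real" where
  "ell2_norm f = sqrt (\<Sum>\<^sub>\<infinity>p. (cmod (f p))\<^sup>2)"

definition ell2_inner :: "lattice_fun \<Rightarrow> lattice_fun \<Rightarrow> complex" where
  "ell2_inner f g = (\<Sum>\<^sub>\<infinity>p. f p * cnj (g p))"

text \<open>The bilinear (transposition) pairing; it agrees with \<^const>\<open>ell2_inner\<close> on real families.\<close>

definition ell2_bilinear :: "lattice_fun \<Rightarrow> lattice_fun \<Rightarrow> complex" where
  "ell2_bilinear f g = (\<Sum>\<^sub>\<infinity>p. f p * g p)"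

text \<open>The coefficients may be unbounded, so a difference expression acts as an operator in \<open>\<ell>\<^sup>2\<close>
  on the finitely supported families, which are dense.\<close>

definition finite_families :: "lattice_fun set" where
  "finite_families = {f. finite {p. f p \<noteq> 0}}"

text \<open>Symmetry with respect to a pairing \<open>B\<close>: an operator in \<open>\<ell>\<^sup>2\<close> with dense domain \<open>S\<close> that can be
  moved from one argument of \<open>B\<close> to the other. With \<open>B\<close> = \<^const>\<open>ell2_inner\<close> this is the usual notion
  of a symmetric operator. With \<open>B\<close> = \<^const>\<open>ell2_bilinear\<close> it says that the matrix of \<open>T\<close> equals its
  transpose, as for complex Jacobi matrices.

  Both are used. Put \<open>\<delta>\<^sub>k = 3 - 2 k\<^sup>2\<close> and \<open>\<alpha>\<^sub>k = (k + 1) (3/2 - k)\<close>. Then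
    \<open>a\<^sub>n\<^sub>+\<^sub>1\<^sub>,\<^sub>m = \<alpha>\<^sub>n \<delta>\<^sub>n\<^sub>+\<^sub>m\<close>, \<open>b\<^sub>n\<^sub>,\<^sub>m\<^sub>+\<^sub>1 = \<alpha>\<^sub>m \<delta>\<^sub>n\<^sub>+\<^sub>m\<close>, \<open>a\<^sub>0\<^sub>,\<^sub>m = b\<^sub>n\<^sub>,\<^sub>0 = 0\<close>,
    \<open>c\<^sub>n\<^sub>,\<^sub>m = 3 + n - 3 n\<^sup>2 + m (m - 1) - 2 n m\<close>, \<open>d\<^sub>n\<^sub>,\<^sub>m = 3 m\<^sup>2 - m + 2 n m - n (n - 1)\<close>
  satisfy the consistency and the boundary conditions and \<open>c\<^sub>n\<^sub>,\<^sub>m - d\<^sub>n\<^sub>,\<^sub>m = \<delta>\<^sub>n\<^sub>+\<^sub>m\<close>, but \<open>a\<^sub>1\<^sub>,\<^sub>2 < 0\<close>.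
  Symmetry of \<open>D\<^sup>-\<^sup>1 \<Delta> D\<close> for \<^const>\<open>ell2_inner\<close> would force \<open>\<bar>h\<^sub>1\<^sub>,\<^sub>2\<bar>\<^sup>2 = 2 a\<^sub>1\<^sub>,\<^sub>2 \<bar>h\<^sub>0\<^sub>,\<^sub>2\<bar>\<^sup>2\<close>, so it is
  only available when the \<open>a\<^sub>n\<^sub>,\<^sub>m\<close> and \<open>b\<^sub>n\<^sub>,\<^sub>m\<close> are positive off the boundary, not just along it.\<close>

definition symmetric_in_ell2 ::
    "(lattice_fun \<Rightarrow> lattice_fun \<Rightarrow> complex) \<Rightarrow> lattice_fun set \<Rightarrow>
     (lattice_fun \<Rightarrow> lattice_fun) \<Rightarrow> bool" where
  "symmetric_in_ell2 B S T \<longleftrightarrow>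
     S \<subseteq> ell2 \<and>
     (\<forall>f\<in>ell2. \<forall>e>0. \<exists>g\<in>S. ell2_norm (\<lambda>p. f p - g p) < e) \<and>
     (\<forall>f\<in>S. T f \<in> ell2) \<and>
     (\<forall>f\<in>S. \<forall>g\<in>S. B (T f) g = B f (T g))"

end

theory Submission
  imports Defs
begin

text \<open>Conjugation by \<open>D\<close> divides the weight of the step \<open>(n, m) \<rightarrow> (n + 1, m)\<close> evenly between both
  directions exactly when \<open>h\<^sub>n\<^sub>+\<^sub>1\<^sub>,\<^sub>m\<^sup>2 = 2 a\<^sub>n\<^sub>+\<^sub>1\<^sub>,\<^sub>m h\<^sub>n\<^sub>,\<^sub>m\<^sup>2\<close>, and likewise \<open>h\<^sub>n\<^sub>,\<^sub>m\<^sub>+\<^sub>1\<^sup>2 = 2 b\<^sub>n\<^sub>,\<^sub>m\<^sub>+\<^sub>1 h\<^sub>n\<^sub>,\<^sub>m\<^sup>2\<close>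
  for the vertical steps. These recursions are solvable if the two ways around each
  unit square agree, \<open>a\<^sub>n\<^sub>+\<^sub>1\<^sub>,\<^sub>m b\<^sub>n\<^sub>+\<^sub>1\<^sub>,\<^sub>m\<^sub>+\<^sub>1 = b\<^sub>n\<^sub>,\<^sub>m\<^sub>+\<^sub>1 a\<^sub>n\<^sub>+\<^sub>1\<^sub>,\<^sub>m\<^sub>+\<^sub>1\<close>. By the consistency conditions the
  ratios \<open>a\<^sub>n\<^sub>+\<^sub>1\<^sub>,\<^sub>m\<^sub>+\<^sub>1 / a\<^sub>n\<^sub>+\<^sub>1\<^sub>,\<^sub>m\<close> and \<open>b\<^sub>n\<^sub>+\<^sub>1\<^sub>,\<^sub>m\<^sub>+\<^sub>1 / b\<^sub>n\<^sub>,\<^sub>m\<^sub>+\<^sub>1\<close> are \<open>c - d\<close> at \<open>(n + 1, m)\<close> and at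
  \<open>(n, m + 1)\<close>, each divided by \<open>c - d\<close> at \<open>(n, m)\<close>, so the extra hypothesis is precisely this
  compatibility.\<close>

section \<open>Finitely supported families and their density\<close>

lemma finite_families_add:
  assumes "f \<in> finite_families" "g \<in> finite_families"
  shows "(\<lambda>p. f p + g p) \<in> finite_families"
proof -
  have "{p. f p + g p \<noteq> 0} \<subseteq> {p. f p \<noteq> 0} \<union> {p. g p \<noteq> 0}" by auto
  then show ?thesis
    using assms unfolding finite_families_def by (auto intro: finite_subset)
qed

lemma finite_families_mult:
  assumes "f \<in> finite_families"
  shows "(\<lambda>p. u p * f p) \<in> finite_families"
  using assms unfolding finite_families_def by (auto elim!: rev_finite_subset)

lemma finite_families_cnj:
  assumes "f \<in> finite_families"
  shows "(\<lambda>p. cnj (f p)) \<in> finite_families"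
  using assms unfolding finite_families_def by simp

lemma finite_families_compose:
  assumes "f \<in> finite_families" "inj \<sigma>"
  shows "(\<lambda>p. f (\<sigma> p)) \<in> finite_families"
  using finite_vimageI[of "{p. f p \<noteq> 0}" \<sigma>] assms
  by (simp add: finite_families_def vimage_def)

lemma finite_families_summable:
  assumes "f \<in> finite_families"
  shows "f summable_on UNIV"
proof -
  have "f summable_on {p. f p \<noteq> 0}"
    using assms by (simp add: finite_families_def)
  then show ?thesis
    by (rule summable_on_cong_neutral[THEN iffD1, rotated -1]) auto
qed

lemma finite_families_ell2:
  assumes "f \<in> finite_families"
  shows "f \<in> ell2"
proof -
  have "(\<lambda>p. (cmod (f p))\<^sup>2) summable_on {p. f p \<noteq> 0}"
    using assms by (simp add: finite_families_def)
  then have "(\<lambda>p. (cmod (f p))\<^sup>2) summable_on UNIV"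
    by (rule summable_on_cong_neutral[THEN iffD1, rotated -1]) auto
  then show ?thesis by (simp add: ell2_def)
qed

lemma finite_families_dense:
  assumes "f \<in> ell2" "e > 0"
  shows "\<exists>g\<in>finite_families. ell2_norm (\<lambda>p. f p - g p) < e"
proof -
  let ?w = "\<lambda>p. (cmod (f p))\<^sup>2"
  have sm: "?w summable_on UNIV" using assms(1) by (simp add: ell2_def)
  \<comment> \<open>Truncating \<open>f\<close> to \<open>F\<close> leaves the tail of the sum as
    squared error. The bound obtained is not strict, so halving \<open>e\<^sup>2\<close> makes the
    error strictly smaller than \<open>e\<^sup>2\<close>.\<close>
  obtain F where F: "finite F" "dist (sum ?w F) (infsum ?w UNIV) \<le> e\<^sup>2 / 2"
    using infsum_finite_approximation[OF sm, of "e\<^sup>2 / 2"] assms(2) by auto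
  define g where "g = (\<lambda>p. if p \<in> F then f p else 0)"
  have "{p. g p \<noteq> 0} \<subseteq> F" by (auto simp: g_def)
  then have "g \<in> finite_families"
    using F(1) by (auto simp: finite_families_def intro: finite_subset)
  moreover have "(\<Sum>\<^sub>\<infinity>p. (cmod (f p - g p))\<^sup>2) = infsum ?w (UNIV - F)"
    by (rule infsum_cong_neutral) (auto simp: g_def)
  then have "(\<Sum>\<^sub>\<infinity>p. (cmod (f p - g p))\<^sup>2) = infsum ?w UNIV - sum ?w F"
    using infsum_Diff[OF sm, of F] F(1) by simp
  then have "(\<Sum>\<^sub>\<infinity>p. (cmod (f p - g p))\<^sup>2) < e\<^sup>2"
    using F(2) assms(2) zero_less_power[OF assms(2), of 2] unfolding dist_real_def by linarith
  then have "ell2_norm (\<lambda>p. f p - g p) < e"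
    unfolding ell2_norm_def using assms(2) real_less_lsqrt by fastforce
  ultimately show ?thesis by blast
qed

section \<open>Shifts along injections and Jacobi-type operators\<close>

definition extend_along :: "('i \<Rightarrow> 'i) \<Rightarrow> ('i \<Rightarrow> complex) \<Rightarrow> 'i \<Rightarrow> complex" where
  "extend_along \<sigma> u = (\<lambda>p. if p \<in> range \<sigma> then u (inv \<sigma> p) else 0)"

lemma extend_along_apply [simp]: "inj \<sigma> \<Longrightarrow> extend_along \<sigma> u (\<sigma> p) = u p"
  by (simp add: extend_along_def)

lemma extend_along_outside: "p \<notin> range \<sigma> \<Longrightarrow> extend_along \<sigma> u p = 0"
  by (simp add: extend_along_def)

lemma cnj_extend_along: "cnj (extend_along \<sigma> u p) = extend_along \<sigma> (\<lambda>q. cnj (u q)) p"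
  by (simp add: extend_along_def)

lemma finite_families_extend_along:
  assumes "f \<in> finite_families"
  shows "extend_along \<sigma> f \<in> finite_families"
proof -
  have "{p. extend_along \<sigma> f p \<noteq> 0} \<subseteq> \<sigma> ` {p. f p \<noteq> 0}"
  proof
    fix p assume "p \<in> {p. extend_along \<sigma> f p \<noteq> 0}"
    then have "p \<in> range \<sigma>" "f (inv \<sigma> p) \<noteq> 0"
      by (simp_all add: extend_along_def split: if_splits)
    then show "p \<in> \<sigma> ` {p. f p \<noteq> 0}"
      using f_inv_into_f[of p \<sigma> UNIV] by (intro image_eqI[of _ _ "inv \<sigma> p"]) simp_all
  qed
  then have "finite {p. extend_along \<sigma> f p \<noteq> 0}"
    by (rule finite_subset) (use assms in \<open>simp add: finite_families_def\<close>)
  then show ?thesis by (simp add: finite_families_def)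
qed

text \<open>Terms off \<open>range \<sigma>\<close> vanish, and the rest is reindexed by
  \<open>\<sigma>\<close>. So \<open>extend_along \<sigma>\<close> is the transpose of composition
  with \<open>\<sigma>\<close>.\<close>

lemma infsum_extend_along:
  assumes "inj \<sigma>"
  shows "(\<Sum>\<^sub>\<infinity>p. extend_along \<sigma> u p * g p) = (\<Sum>\<^sub>\<infinity>p. u p * g (\<sigma> p))"
proof -
  have "(\<Sum>\<^sub>\<infinity>p. extend_along \<sigma> u p * g p) = (\<Sum>\<^sub>\<infinity>p\<in>range \<sigma>. extend_along \<sigma> u p * g p)"
    by (rule infsum_cong_neutral) (auto simp: extend_along_outside)
  also have "\<dots> = (\<Sum>\<^sub>\<infinity>p. u p * g (\<sigma> p))"
    by (subst infsum_reindex) (use assms in \<open>simp_all add: o_def\<close>)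
  finally show ?thesis .
qed

text \<open>A Jacobi matrix with two shifts: \<open>A p\<close> weights the edge between
  \<open>p\<close> and \<open>\<sigma> p\<close> in both directions, \<open>B p\<close> the one
  between \<open>p\<close> and \<open>\<tau> p\<close>, so the matrix is symmetric by
  construction.\<close>

definition jacobi_op ::
    "(nat \<times> nat \<Rightarrow> nat \<times> nat) \<Rightarrow> (nat \<times> nat \<Rightarrow> nat \<times> nat) \<Rightarrow>
     lattice_fun \<Rightarrow> lattice_fun \<Rightarrow> lattice_fun \<Rightarrow> lattice_fun \<Rightarrow> lattice_fun" where
  "jacobi_op \<sigma> \<tau> A B V f = (\<lambda>p. A p * f (\<sigma> p) + B p * f (\<tau> p) + V p * f p
     + extend_along \<sigma> (\<lambda>q. A q * f q) p + extend_along \<tau> (\<lambda>q. B q * f q) p)"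

lemma jacobi_op_finite_families:
  assumes "inj \<sigma>" "inj \<tau>" "f \<in> finite_families"
  shows "jacobi_op \<sigma> \<tau> A B V f \<in> finite_families"
  unfolding jacobi_op_def
  by (intro finite_families_add finite_families_mult finite_families_extend_along assms(3)
      finite_families_compose[OF assms(3,1)] finite_families_compose[OF assms(3,2)])

text \<open>Finite support of \<open>g\<close> allows splitting the sum, and transposition moves the
  backward shifts onto \<open>g\<close>. Exchanging \<open>f\<close> and \<open>g\<close> then swaps
  the first sum with the fourth and the second with the fifth, which gives symmetry.\<close>

lemma jacobi_op_bilinear:
  assumes inj: "inj \<sigma>" "inj \<tau>" and f: "f \<in> finite_families" and g: "g \<in> finite_families"
  shows "ell2_bilinear (jacobi_op \<sigma> \<tau> A B V f) g =
           (\<Sum>\<^sub>\<infinity>p. A p * f (\<sigma> p) * g p) + (\<Sum>\<^sub>\<infinity>p. B p * f (\<tau> p) * g p) + (\<Sum>\<^sub>\<infinity>p. V p * f p * g p)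
           + (\<Sum>\<^sub>\<infinity>p. A p * f p * g (\<sigma> p)) + (\<Sum>\<^sub>\<infinity>p. B p * f p * g (\<tau> p))"
proof -
  have sm: "(\<lambda>p. u p * g p) summable_on UNIV" for u
    by (intro finite_families_summable finite_families_mult g)
  show ?thesis
    unfolding ell2_bilinear_def jacobi_op_def distrib_right
    by (simp add: infsum_add summable_on_add sm infsum_extend_along inj)
qed

lemma jacobi_op_bilinear_symmetric:
  assumes "inj \<sigma>" "inj \<tau>" "f \<in> finite_families" "g \<in> finite_families"
  shows "ell2_bilinear (jacobi_op \<sigma> \<tau> A B V f) g = ell2_bilinear f (jacobi_op \<sigma> \<tau> A B V g)"
proof -
  have "ell2_bilinear f (jacobi_op \<sigma> \<tau> A B V g) = ell2_bilinear (jacobi_op \<sigma> \<tau> A B V g) f"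
    by (simp add: ell2_bilinear_def mult.commute)
  with assms show ?thesis
    by (simp add: jacobi_op_bilinear mult.assoc mult.commute mult.left_commute)
qed

lemma cnj_jacobi_op:
  assumes "\<And>p. cnj (A p) = A p" "\<And>p. cnj (B p) = B p" "\<And>p. cnj (V p) = V p"
  shows "cnj (jacobi_op \<sigma> \<tau> A B V f p) = jacobi_op \<sigma> \<tau> A B V (\<lambda>p. cnj (f p)) p"
  by (simp add: jacobi_op_def cnj_extend_along assms)

lemma jacobi_op_symmetric_bilinear:
  assumes "inj \<sigma>" "inj \<tau>"
  shows "symmetric_in_ell2 ell2_bilinear finite_families (jacobi_op \<sigma> \<tau> A B V)"
  unfolding symmetric_in_ell2_def
  using finite_families_ell2 finite_families_dense jacobi_op_finite_families[OF assms]
    jacobi_op_bilinear_symmetric[OF assms] by blast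

lemma jacobi_op_symmetric_inner:
  assumes inj: "inj \<sigma>" "inj \<tau>"
    and real: "\<And>p. cnj (A p) = A p" "\<And>p. cnj (B p) = B p" "\<And>p. cnj (V p) = V p"
  shows "symmetric_in_ell2 ell2_inner finite_families (jacobi_op \<sigma> \<tau> A B V)"
proof -
  let ?T = "jacobi_op \<sigma> \<tau> A B V"
  have "ell2_inner (?T f) g = ell2_inner f (?T g)"
    if "f \<in> finite_families" "g \<in> finite_families" for f g
  proof -
    \<comment> \<open>Real weights make the operator commute with conjugation, so bilinear symmetry
      applied to \<open>f\<close> and the conjugate of \<open>g\<close> suffices.\<close>
    have inner: "ell2_inner u v = ell2_bilinear u (\<lambda>p. cnj (v p))" for u v
      by (simp add: ell2_inner_def ell2_bilinear_def)
    show ?thesis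
      using jacobi_op_bilinear_symmetric[OF inj that(1) finite_families_cnj[OF that(2)]]
      by (simp add: inner cnj_jacobi_op[OF real])
  qed
  then show ?thesis
    unfolding symmetric_in_ell2_def
    using finite_families_ell2 finite_families_dense jacobi_op_finite_families[OF inj] by blast
qed

section \<open>Conjugation of the difference operator by a diagonal one\<close>

lemma inv_diagonal_op:
  assumes "\<And>p. h p \<noteq> 0"
  shows "inv (diagonal_op h) = diagonal_op (\<lambda>p. inverse (h p))"
proof (rule inv_unique_comp)
  show "diagonal_op h \<circ> diagonal_op (\<lambda>p. inverse (h p)) = id"
    using assms by (auto simp: diagonal_op_def fun_eq_iff)
  show "diagonal_op (\<lambda>p. inverse (h p)) \<circ> diagonal_op h = id"
    using assms by (auto simp: diagonal_op_def fun_eq_iff)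
qed

definition step_right :: "nat \<times> nat \<Rightarrow> nat \<times> nat" where
  "step_right p = (Suc (fst p), snd p)"

definition step_up :: "nat \<times> nat \<Rightarrow> nat \<times> nat" where
  "step_up p = (fst p, Suc (snd p))"

lemma inj_step_right: "inj step_right"
  by (auto simp: inj_def step_right_def prod_eq_iff)

lemma inj_step_up: "inj step_up"
  by (auto simp: inj_def step_up_def prod_eq_iff)

text \<open>The default value 0 off the range reproduces the convention that families vanish at
  index -1.\<close>

lemma extend_along_step_right:
  "extend_along step_right u (n, m) = (if n = 0 then 0 else u (n - 1, m))"
proof (cases n)
  case 0
  then show ?thesis by (auto simp: step_right_def intro!: extend_along_outside)
next
  case (Suc k)
  then show ?thesis
    using extend_along_apply[OF inj_step_right, of u "(k, m)"] by (simp add: step_right_def)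
qed

lemma extend_along_step_up:
  "extend_along step_up u (n, m) = (if m = 0 then 0 else u (n, m - 1))"
proof (cases m)
  case 0
  then show ?thesis by (auto simp: step_up_def intro!: extend_along_outside)
next
  case (Suc k)
  then show ?thesis
    using extend_along_apply[OF inj_step_up, of u "(n, k)"] by (simp add: step_up_def)
qed

lemma conjugate_Delta_eq_jacobi_op:
  assumes nz: "\<And>p. h p \<noteq> 0"
    and right: "\<And>n m. (h (Suc n, m))\<^sup>2 = complex_of_real (2 * a (Suc n) m) * (h (n, m))\<^sup>2"
    and up: "\<And>n m. (h (n, Suc m))\<^sup>2 = complex_of_real (2 * b n (Suc m)) * (h (n, m))\<^sup>2"
  shows "inv (diagonal_op h) \<circ> Delta a b c d \<circ> diagonal_op h =
           jacobi_op step_right step_up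
             (\<lambda>p. h (step_right p) / (2 * h p)) (\<lambda>p. h (step_up p) / (2 * h p))
             (\<lambda>(n, m). complex_of_real ((c n m + d n m) / 2))"
proof -
  \<comment> \<open>With \<open>u\<close> and \<open>v\<close> the values of \<open>h\<close> before
    and after a step, the conjugated backward weight \<open>x * u / v\<close> equals the forward
    weight \<open>v / (2 * u)\<close>.\<close>
  have balance: "inverse v * (complex_of_real x * (u * y)) = v / (2 * u) * y"
    if "v\<^sup>2 = complex_of_real (2 * x) * u\<^sup>2" "u \<noteq> 0" "v \<noteq> 0" for u v y x
  proof -
    have "complex_of_real x * u / v = v / (2 * u)"
      using that by (simp add: field_simps power2_eq_square)
    moreover have "inverse v * (complex_of_real x * (u * y)) = complex_of_real x * u / v * y"
      by (simp add: divide_inverse)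
    ultimately show ?thesis by simp
  qed
  have "inverse (h (n, m)) * Delta a b c d (\<lambda>p. h p * f p) (n, m) =
      h (Suc n, m) / (2 * h (n, m)) * f (Suc n, m) + h (n, Suc m) / (2 * h (n, m)) * f (n, Suc m)
      + complex_of_real ((c n m + d n m) / 2) * f (n, m)
      + (if n = 0 then 0 else h (n, m) / (2 * h (n - 1, m)) * f (n - 1, m))
      + (if m = 0 then 0 else h (n, m) / (2 * h (n, m - 1)) * f (n, m - 1))" for f n m
  proof -
    have lower_a: "inverse (h (n, m)) * (complex_of_real (a n m) * (if n = 0 then 0 else h (n - 1, m) * f (n - 1, m)))
        = (if n = 0 then 0 else h (n, m) / (2 * h (n - 1, m)) * f (n - 1, m))"
    proof (cases n)
      case (Suc k)
      then show ?thesis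
        using balance[OF right[of k m] nz[of "(k, m)"] nz[of "(Suc k, m)"]] by simp
    qed simp
    have lower_b: "inverse (h (n, m)) * (complex_of_real (b n m) * (if m = 0 then 0 else h (n, m - 1) * f (n, m - 1)))
        = (if m = 0 then 0 else h (n, m) / (2 * h (n, m - 1)) * f (n, m - 1))"
    proof (cases m)
      case (Suc k)
      then show ?thesis
        using balance[OF up[of n k] nz[of "(n, k)"] nz[of "(n, Suc k)"]] by simp
    qed simp
    have upper: "inverse (h (n, m)) * (1 / 2 * (u * y)) = u / (2 * h (n, m)) * y" for u y
      using nz[of "(n, m)"] by (simp add: field_simps)
    have middle: "inverse (h (n, m)) * (v * (h (n, m) * y)) = v * y" for v y
      using nz by simp
    show ?thesis
      unfolding Delta_def prod.case distrib_left lower_a lower_b upper middle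
      by (simp only: Suc_eq_plus1)
  qed
  then show ?thesis
    by (auto simp: fun_eq_iff inv_diagonal_op[OF nz] diagonal_op_def jacobi_op_def
        extend_along_step_right extend_along_step_up step_right_def step_up_def)
qed

section \<open>Compatibility around unit squares and the resulting weights\<close>

lemma consistency_conditions_square:
  assumes "consistency_conditions a b c d"
    and "c (n + 1) m - d (n + 1) m = c n (m + 1) - d n (m + 1)"
  shows "a (Suc n) m * b (Suc n) (Suc m) = b n (Suc m) * a (Suc n) (Suc m)"
    and "a (Suc n) m \<noteq> 0" and "b n (Suc m) \<noteq> 0"
proof -
  have nz: "c i j - d i j \<noteq> 0" for i j
    using assms(1) by (simp add: consistency_conditions_def)
  have ra: "a (Suc n) (Suc m) / a (Suc n) m = (c (Suc n) m - d (Suc n) m) / (c n m - d n m)"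
    using assms(1) unfolding consistency_conditions_def
    by (metis Suc_eq_plus1 diff_Suc_1 le_add2)
  have rb: "b (Suc n) (Suc m) / b n (Suc m) = (c n (Suc m) - d n (Suc m)) / (c n m - d n m)"
    using assms(1) unfolding consistency_conditions_def
    by (metis Suc_eq_plus1 diff_Suc_1 le_add2)
  \<comment> \<open>A zero denominator would make the left side of \<open>ra\<close> equal to 0,
    while its right side is nonzero.\<close>
  show a0: "a (Suc n) m \<noteq> 0"
    using ra nz[of "Suc n" m] nz[of n m] by auto
  show b0: "b n (Suc m) \<noteq> 0"
    using rb nz[of n "Suc m"] nz[of n m] by auto
  have "a (Suc n) (Suc m) / a (Suc n) m = b (Suc n) (Suc m) / b n (Suc m)"
    using ra rb assms(2) by simp
  then show "a (Suc n) m * b (Suc n) (Suc m) = b n (Suc m) * a (Suc n) (Suc m)"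
    using a0 b0 by (simp add: frac_eq_eq mult.commute)
qed

text \<open>The intended value of \<open>h\<^sup>2\<close>: the step factors multiplied along the
  path from the origin right to \<open>(n, 0)\<close>, then up to \<open>(n, m)\<close>.\<close>

definition squared_weight :: "coeffs \<Rightarrow> coeffs \<Rightarrow> nat \<Rightarrow> nat \<Rightarrow> real" where
  "squared_weight a b n m = (\<Prod>i<n. 2 * a (Suc i) 0) * (\<Prod>j<m. 2 * b n (Suc j))"

lemma squared_weight_up:
  "squared_weight a b n (Suc m) = 2 * b n (Suc m) * squared_weight a b n m"
  by (simp add: squared_weight_def)

text \<open>On the bottom row this is the definition. The square relation carries it one row up,
  trading right-then-up for up-then-right.\<close>

lemma squared_weight_right:
  assumes "\<And>n m. a (Suc n) m * b (Suc n) (Suc m) = b n (Suc m) * a (Suc n) (Suc m)"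
  shows "squared_weight a b (Suc n) m = 2 * a (Suc n) m * squared_weight a b n m"
proof (induction m)
  case 0
  then show ?case by (simp add: squared_weight_def)
next
  case (Suc m)
  have "squared_weight a b (Suc n) (Suc m)
      = 4 * (a (Suc n) m * b (Suc n) (Suc m)) * squared_weight a b n m"
    by (simp add: squared_weight_up Suc.IH)
  also have "\<dots> = 2 * a (Suc n) (Suc m) * squared_weight a b n (Suc m)"
    by (simp add: squared_weight_up assms)
  finally show ?case .
qed

lemma cnj_csqrt_of_nonneg: "x \<ge> 0 \<Longrightarrow> cnj (csqrt (complex_of_real x)) = csqrt (complex_of_real x)"
  by (simp add: of_real_sqrt [symmetric])

theorem theorem6p1:
  fixes a b c d :: "nat \<Rightarrow> nat \<Rightarrow> real"
  assumes "consistency_conditions a b c d"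
    and "boundary_conditions a b"
    and "\<And>n m. c (n + 1) m - d (n + 1) m = c n (m + 1) - d n (m + 1)"
  shows "\<exists>h :: nat \<times> nat \<Rightarrow> complex. (\<forall>p. h p \<noteq> 0) \<and>
           (let \<Delta>\<^sub>s = inv (diagonal_op h) \<circ> Delta a b c d \<circ> diagonal_op h
            in symmetric_in_ell2 ell2_bilinear finite_families \<Delta>\<^sub>s \<and>
               ((\<forall>n m. a (n + 1) m > 0 \<and> b n (m + 1) > 0) \<longrightarrow>
                  symmetric_in_ell2 ell2_inner finite_families \<Delta>\<^sub>s))"
proof -
  note square = consistency_conditions_square[of a b c d, OF assms(1) assms(3)]
  let ?H = "squared_weight a b"
  \<comment> \<open>The root is complex because the weight may be negative when \<open>a\<close> or
    \<open>b\<close> changes sign off the boundary.\<close>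
  define h where "h = (\<lambda>(n, m). csqrt (complex_of_real (?H n m)))"
  have nz: "h p \<noteq> 0" for p
    using square(2,3) by (auto simp: h_def squared_weight_def split: prod.split)
  have h_eq: "inv (diagonal_op h) \<circ> Delta a b c d \<circ> diagonal_op h =
      jacobi_op step_right step_up
        (\<lambda>p. h (step_right p) / (2 * h p)) (\<lambda>p. h (step_up p) / (2 * h p))
        (\<lambda>(n, m). complex_of_real ((c n m + d n m) / 2))"
    by (rule conjugate_Delta_eq_jacobi_op[OF nz])
      (simp_all add: h_def squared_weight_up squared_weight_right[of a b, OF square(1)])
  \<comment> \<open>Positive coefficients make the weights nonnegative and \<open>h\<close> real,
    hence also the quotients of values of \<open>h\<close> in the Jacobi form, as the inner-product
    case requires.\<close>
  have "cnj (h p) = h p" if "\<forall>n m. a (n + 1) m > 0 \<and> b n (m + 1) > 0" for p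
  proof -
    have "?H n m \<ge> 0" for n m
      unfolding squared_weight_def using that
      by (intro mult_nonneg_nonneg prod_nonneg) (auto intro: less_imp_le)
    then show ?thesis by (auto simp: h_def cnj_csqrt_of_nonneg split: prod.split)
  qed
  then have "symmetric_in_ell2 ell2_inner finite_families
      (inv (diagonal_op h) \<circ> Delta a b c d \<circ> diagonal_op h)"
    if "\<forall>n m. a (n + 1) m > 0 \<and> b n (m + 1) > 0"
    unfolding h_eq using that
    by (intro jacobi_op_symmetric_inner inj_step_right inj_step_up) (auto split: prod.split)
  moreover have "symmetric_in_ell2 ell2_bilinear finite_families
      (inv (diagonal_op h) \<circ> Delta a b c d \<circ> diagonal_op h)"
    unfolding h_eq by (intro jacobi_op_symmetric_bilinear inj_step_right inj_step_up)
  ultimately show ?thesis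
    using nz unfolding Let_def by blast
qed

end
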